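(* Suppose that a group pair $\mathcal F=(G,\varphi)$ consists of finite, cyclic groups, with $G=\langle G_x:x\in I\rangle$ and $\varphi=\langle\varphi_{xy}:(x,y)\in\mathcal E\rangle$, and satisfies the four frame conditions. If $m_{xy}=|G_x/H_{xy}|$ for every pair $(x,y)$ in $\mathcal E$, where $H_{xy}$ is the kernel of $\varphi_{xy}$, then the resulting system $m=\langle m_{xy}:(x,y)\in\mathcal E\rangle$ satisfies the index conditions.
   Context: A group pair is $\mathcal F=(\langle G_x:x\in I\rangle,\langle\varphi_{xy}:(x,y)\in\mathcal E\rangle)$, where the $G_x$ are pairwise disjoint groups (operation $\circ$, identity $e_x$), $\mathcal E$ is an equivalence relation on $I$, and for each $(x,y)\in\mathcal E$, $\varphi_{xy}$ is an isomorphism from $G_x/H_{xy}$ to $G_y/K_{xy}$ for some normal subgroups $H_{xy}$ of $G_x$ and $K_{xy}$ of $G_y$. The subgroup $H_{xy}$ is called the kernel of $\varphi_{xy}$. For subgroups $H,K$ of a group, $H\circ K=\{h\circ k:h\in H,k\in K\}$. For a normal subgroup $N$ of $G_x$ that contains $H_{xy}$, $\varphi_{xy}[N]$ is the union of the images under $\varphi_{xy}$ of the cosets of $H_{xy}$ contained in $N$. The four frame conditions are, for all $(x,y),(y,z)\in\mathcal E$: (i) $\varphi_{xx}$ is the identity automorphism of $G_x/\{e_x\}$ for all $x\in I$; (ii) $\varphi_{yx}=\varphi_{xy}^{-1}$; (iii) $\varphi_{xy}[H_{xy}\circ H_{xz}]=K_{xy}\circ H_{yz}$; (iv) $\hat\varphi_{xy}\mid\hat\varphi_{yz}=\hat\varphi_{xz}$.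 Here $\hat\varphi_{xy}:G_x/(H_{xy}\circ H_{xz})\to G_y/(K_{xy}\circ H_{yz})$, $\hat\varphi_{yz}:G_y/(K_{xy}\circ H_{yz})\to G_z/(K_{xz}\circ K_{yz})$ and $\hat\varphi_{xz}:G_x/(H_{xy}\circ H_{xz})\to G_z/(K_{xz}\circ K_{yz})$ are the isomorphisms induced by $\varphi_{xy},\varphi_{yz},\varphi_{xz}$ respectively (each sends a coset, viewed as a union of cosets of the smaller kernel subgroup, to the union of the images of these cosets), and $\mid$ denotes composition, first the left function and then the right one. Index conditions: a system $m=\langle m_{xy}:(x,y)\in\mathcal E\rangle$ of positive integers satisfies the index conditions (with respect to $G$) if, for all $(x,y),(y,z)\in\mathcal E$: (i) $m_{xy}$ is a common divisor of the orders of $G_x$ and $G_y$; (ii) $m_{xx}=|G_x|$; (iii) $m_{yx}=m_{xy}$; (iv) $\gcd(m_{xy},m_{yz})=\gcd(m_{xy},m_{xz})=\gcd(m_{xz},m_{yz})$. *)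

theory Defs
  imports "HOL-Algebra.Algebra"
begin

text \<open>A map between quotient groups does not record its quotients in HOL, so the families
  \<open>H\<close> (kernels) and \<open>K\<close> of normal subgroups are explicit components. All families are total
  functions; only their values on \<open>I\<close> or \<open>E\<close> matter, and only the values of \<open>\<phi> x y\<close> on the
  cosets of \<open>H x y\<close>.\<close>

locale group_pair =
  fixes I :: "'i set"
    and G :: "'i \<Rightarrow> 'a monoid"
    and E :: "('i \<times> 'i) set"
    and H K :: "'i \<Rightarrow> 'i \<Rightarrow> 'a set"
    and \<phi> :: "'i \<Rightarrow> 'i \<Rightarrow> 'a set \<Rightarrow> 'a set"
  assumes group_G: "x \<in> I \<Longrightarrow> group (G x)"
    and disjoint_G: "\<lbrakk>x \<in> I; y \<in> I; x \<noteq> y\<rbrakk> \<Longrightarrow> carrier (G x) \<inter> carrier (G y) = {}"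
    and equiv_E: "equiv I E"
    and normal_H: "(x, y) \<in> E \<Longrightarrow> H x y \<lhd> G x"
    and normal_K: "(x, y) \<in> E \<Longrightarrow> K x y \<lhd> G y"
    and iso_\<phi>: "(x, y) \<in> E \<Longrightarrow> \<phi> x y \<in> iso (G x Mod H x y) (G y Mod K x y)"

text \<open>For a map \<open>f\<close> on the cosets of \<open>N\<close>, this is the set \<open>f[S]\<close>, for \<open>S\<close> a union of cosets
  of \<open>N\<close> (a subgroup containing \<open>N\<close>, or a coset of such a subgroup).\<close>

definition coset_image ::
    "'a monoid \<Rightarrow> 'a set \<Rightarrow> ('a set \<Rightarrow> 'a set) \<Rightarrow> 'a set \<Rightarrow> 'a set" where
  "coset_image A N f S = \<Union> (f ` {C \<in> carrier (A Mod N). C \<subseteq> S})"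

text \<open>The map induced on the coarser quotient \<open>A Mod M\<close>, where \<open>N \<subseteq> M\<close>, by a map \<open>f\<close> on
  \<open>A Mod N\<close>. It is restricted to its domain, so that equality of induced maps is equality of
  functions.\<close>

definition induced_map ::
    "'a monoid \<Rightarrow> 'a set \<Rightarrow> 'a set \<Rightarrow> ('a set \<Rightarrow> 'a set) \<Rightarrow> 'a set \<Rightarrow> 'a set" where
  "induced_map A N M f = restrict (coset_image A N f) (carrier (A Mod M))"

text \<open>Two maps between quotients are equal only if their domains and codomains agree, hence
  the equations between the subgroups in the first two conditions. In the last condition,
  \<open>compose\<close> applies its rightmost argument first.\<close>

definition frame_conditions ::
    "'i set \<Rightarrow> ('i \<Rightarrow> 'a monoid) \<Rightarrow> ('i \<times> 'i) set \<Rightarrow> ('i \<Rightarrow> 'i \<Rightarrow> 'a set) \<Rightarrow>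
     ('i \<Rightarrow> 'i \<Rightarrow> 'a set) \<Rightarrow> ('i \<Rightarrow> 'i \<Rightarrow> 'a set \<Rightarrow> 'a set) \<Rightarrow> bool" where
  "frame_conditions I G E H K \<phi> \<longleftrightarrow>
    (\<forall>x\<in>I. H x x = {\<one>\<^bsub>G x\<^esub>} \<and> K x x = {\<one>\<^bsub>G x\<^esub>} \<and>
      (\<forall>C\<in>carrier (G x Mod {\<one>\<^bsub>G x\<^esub>}). \<phi> x x C = C)) \<and>
    (\<forall>x y. (x, y) \<in> E \<longrightarrow> H y x = K x y \<and> K y x = H x y \<and>
      (\<forall>D\<in>carrier (G y Mod K x y). \<phi> y x D = inv_into (carrier (G x Mod H x y)) (\<phi> x y) D)) \<and>
    (\<forall>x y z. (x, y) \<in> E \<and> (y, z) \<in> E \<longrightarrow>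
      coset_image (G x) (H x y) (\<phi> x y) (H x y <#>\<^bsub>G x\<^esub> H x z) = K x y <#>\<^bsub>G y\<^esub> H y z) \<and>
    (\<forall>x y z. (x, y) \<in> E \<and> (y, z) \<in> E \<longrightarrow>
      compose (carrier (G x Mod (H x y <#>\<^bsub>G x\<^esub> H x z)))
        (induced_map (G y) (H y z) (K x y <#>\<^bsub>G y\<^esub> H y z) (\<phi> y z))
        (induced_map (G x) (H x y) (H x y <#>\<^bsub>G x\<^esub> H x z) (\<phi> x y))
      = induced_map (G x) (H x z) (H x y <#>\<^bsub>G x\<^esub> H x z) (\<phi> x z))"

definition index_conditions ::
    "'i set \<Rightarrow> ('i \<Rightarrow> 'a monoid) \<Rightarrow> ('i \<times> 'i) set \<Rightarrow> ('i \<Rightarrow> 'i \<Rightarrow> nat) \<Rightarrow> bool" where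
  "index_conditions I G E m \<longleftrightarrow>
    (\<forall>x y. (x, y) \<in> E \<longrightarrow> m x y > 0) \<and>
    (\<forall>x y. (x, y) \<in> E \<longrightarrow> m x y dvd order (G x) \<and> m x y dvd order (G y)) \<and>
    (\<forall>x\<in>I. m x x = order (G x)) \<and>
    (\<forall>x y. (x, y) \<in> E \<longrightarrow> m y x = m x y) \<and>
    (\<forall>x y z. (x, y) \<in> E \<and> (y, z) \<in> E \<longrightarrow>
      gcd (m x y) (m y z) = gcd (m x y) (m x z) \<and>
      gcd (m x y) (m x z) = gcd (m x z) (m y z))"

end

theory Submission
  imports Defs
begin

text \<open>The subgroup product of two subgroups of a finite cyclic group has index the greatest
  common divisor of the two indices (\<open>card_rcosets_set_mult\<close>). A quotient isomorphism that
  carries a subgroup \<open>S\<close> of one group onto a subgroup \<open>T\<close> of another preserves indices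
  (\<open>card_rcosets_coset_image\<close>): both are the index of the same subgroup of the common quotient.

  The third frame condition says that \<open>\<phi> x y\<close> carries the product of \<open>H x y\<close> and \<open>H x z\<close> onto
  the product of \<open>K x y\<close> and \<open>H y z\<close>. Since \<open>H x y\<close> and \<open>K x y\<close> both have index \<open>m x y\<close>,
  comparing indices gives \<open>gcd (m x y) (m x z) = gcd (m x y) (m y z)\<close>. The second gcd equation
  is the same statement for the triple \<open>(x, z, y)\<close>, by the symmetry of \<open>m\<close>.

  The other index conditions hold because \<open>m x y\<close> is an index in both groups, of \<open>H x y\<close> in
  \<open>G x\<close> and of \<open>K x y = H y x\<close> in \<open>G y\<close>, and because \<open>H x x\<close> is trivial.\<close>

text \<open>If \<open>g\<close> generates the group and its order is \<open>d * l\<close>, then the elements that \<open>l\<close> annihilates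
  are the powers of \<open>g ^ d\<close>, an element of order dividing \<open>l\<close>.\<close>

lemma (in group) cyclic_card_roots_le:
  assumes fin: "finite (carrier G)" and cyc: "cyclic_group G" and l: "l dvd order G"
  shows "card {x \<in> carrier G. x [^] l = \<one>} \<le> l"
proof -
  obtain g where g: "g \<in> carrier G" and carr: "carrier G = range (\<lambda>n::int. g [^] n)"
    using cyc cyclic_group by blast
  have "generate G {g} = carrier G"
    using carr g generate_pow by auto
  then have ord_g: "ord g = order G"
    using generate_pow_card[OF g] by (simp add: order_def)
  obtain d where d: "order G = l * d" using l by blast
  have "order G > 0" using fin order_gt_0_iff_finite by blast
  then have "l > 0" "d > 0" using d by auto
  define h where "h = g [^] d"
  have h: "h \<in> carrier G" using g h_def by simp
  have h_l: "h [^] l = \<one>"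
    unfolding h_def using g ord_g d by (simp add: nat_pow_pow pow_eq_id mult.commute)
  have "{x \<in> carrier G. x [^] l = \<one>} \<subseteq> (\<lambda>i. h [^] i) ` {..<l}"
  proof
    fix x assume x: "x \<in> {x \<in> carrier G. x [^] l = \<one>}"
    then obtain k :: int where k: "x = g [^] k" using carr by auto
    have "g [^] (k * int l) = \<one>"
      using x k g by (simp add: int_pow_pow flip: int_pow_int)
    then have "int (l * d) dvd k * int l"
      using g int_pow_eq_id ord_g d by metis
    then have "int d dvd k"
      using \<open>l > 0\<close> by (simp add: mult.commute)
    then obtain j where j: "k = int d * j" by blast
    have "x = h [^] j"
      unfolding h_def k j using g by (simp add: int_pow_pow flip: int_pow_int)
    also have "\<dots> = h [^] (j mod int l)"
    proof -
      have "int (ord h) dvd int l" using h h_l pow_eq_id by simp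
      then have "int (ord h) dvd j mod int l - j"
        by (meson dvd_trans mod_eq_dvd_iff mod_mod_trivial)
      then show ?thesis using int_pow_eq[OF h] by blast
    qed
    also have "\<dots> = h [^] nat (j mod int l)"
      using \<open>l > 0\<close> by (simp flip: int_pow_int)
    finally show "x \<in> (\<lambda>i. h [^] i) ` {..<l}"
      using \<open>l > 0\<close> by (intro image_eqI[of _ _ "nat (j mod int l)"]) (auto simp: nat_less_iff)
  qed
  from surj_card_le[OF finite_lessThan this] show ?thesis by simp
qed

lemma (in group) card_rcosets_dvd_mono:
  assumes fin: "finite (carrier G)" and A: "subgroup A G" and B: "subgroup B G"
    and AB: "A \<subseteq> B"
  shows "card (rcosets B) dvd card (rcosets A)"
proof -
  interpret B: group "G\<lparr>carrier := B\<rparr>"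
    using B subgroup_imp_group by blast
  have "card (rcosets\<^bsub>G\<lparr>carrier := B\<rparr>\<^esub> A) * card A = card B"
    using B.lagrange[OF subgroup_incl[OF A B AB]] by (simp add: order_def)
  then have "card A dvd card B" by (metis dvd_triv_right)
  then obtain t where t: "card B = card A * t" by blast
  have "card A > 0"
    using A fin subgroup.finite_imp_card_positive by blast
  moreover have "card (rcosets A) * card A = card (rcosets B) * t * card A"
    using lagrange[OF A] lagrange[OF B] t by (simp add: mult_ac)
  ultimately show ?thesis by simp
qed

text \<open>The index of the product divides both indices \<open>a\<close> and \<open>b\<close>, hence \<open>gcd a b\<close>. It is not
  smaller: with \<open>n\<close> the order of the group, both factors, hence also their product, consist of
  elements that \<open>n div gcd a b\<close> annihilates, and there are at most \<open>n div gcd a b\<close> of these in a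
  cyclic group.\<close>

lemma (in group) card_rcosets_set_mult:
  assumes fin: "finite (carrier G)" and cyc: "cyclic_group G"
    and A: "subgroup A G" and B: "subgroup B G"
  shows "card (rcosets (A <#> B)) = gcd (card (rcosets A)) (card (rcosets B))"
proof -
  interpret comm_group G using cyc cyclic_imp_abelian_group by blast
  define d where "d = gcd (card (rcosets A)) (card (rcosets B))"
  have AB: "subgroup (A <#> B) G" using A B mult_subgroups by blast
  have A_AB: "A \<subseteq> A <#> B"
    using A B subgroup.one_closed subgroup.mem_carrier unfolding set_mult_def by force
  have B_AB: "B \<subseteq> A <#> B"
    using A B subgroup.one_closed subgroup.mem_carrier unfolding set_mult_def by force
  have "card (rcosets (A <#> B)) dvd d"
    unfolding d_def using card_rcosets_dvd_mono[OF fin _ AB] A B A_AB B_AB by simp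
  moreover have "d dvd card (rcosets (A <#> B))"
  proof -
    have n: "order G > 0" using fin order_gt_0_iff_finite by blast
    have "d dvd order G"
      using lagrange[OF A] unfolding d_def by (metis dvd_mult2 gcd_dvd1)
    then obtain l where l: "order G = d * l" by blast
    then have "d > 0" "l > 0" using n by auto
    have annihilated: "x [^] l = \<one>"
      if C: "subgroup C G" and dC: "d dvd card (rcosets C)" and x: "x \<in> C" for C x
    proof -
      obtain e where "card (rcosets C) = d * e" using dC by blast
      then have "card C dvd l"
        using lagrange[OF C] l \<open>d > 0\<close> by (metis dvd_triv_right mult.assoc mult_left_cancel neq0_conv)
      moreover have "x [^] card C = \<one>"
      proof -
        interpret C: group "G\<lparr>carrier := C\<rparr>" using C subgroup_imp_group by blast
        show ?thesis
          using C.pow_order_eq_1[of x] x by (simp add: order_def flip: nat_pow_consistent)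
      qed
      ultimately show ?thesis
        using C x pow_eq_id subgroup.mem_carrier dvd_trans by metis
    qed
    have "A <#> B \<subseteq> {x \<in> carrier G. x [^] l = \<one>}"
    proof
      fix x assume "x \<in> A <#> B"
      then obtain a b where ab: "a \<in> A" "b \<in> B" "x = a \<otimes> b" unfolding set_mult_def by blast
      have carr: "a \<in> carrier G" "b \<in> carrier G" using ab A B subgroup.mem_carrier by metis+
      have "a [^] l = \<one>" "b [^] l = \<one>"
        using annihilated[OF A] annihilated[OF B] ab by (simp_all add: d_def)
      then show "x \<in> {x \<in> carrier G. x [^] l = \<one>}"
        using carr ab by (simp add: nat_pow_distrib)
    qed
    then have "card (A <#> B) \<le> card {x \<in> carrier G. x [^] l = \<one>}"
      using fin by (intro card_mono) auto
    also have "\<dots> \<le> l" using cyclic_card_roots_le[OF fin cyc] l by simp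
    finally have "card (A <#> B) \<le> l" .
    then have "d * l \<le> card (rcosets (A <#> B)) * l"
      using lagrange[OF AB] l by (metis mult_le_mono2)
    then have "d \<le> card (rcosets (A <#> B))" using \<open>l > 0\<close> by simp
    with \<open>card (rcosets (A <#> B)) dvd d\<close> \<open>d > 0\<close> show ?thesis
      by (metis dvd_imp_le dvd_refl le_antisym)
  qed
  ultimately show ?thesis using d_def by (metis dvd_antisym)
qed

lemma (in group) card_Union_rcosets:
  assumes fin: "finite (carrier G)" and N: "subgroup N G" and \<C>: "\<C> \<subseteq> rcosets N"
  shows "card (\<Union>\<C>) = card \<C> * card N"
proof -
  have sub: "\<Union>\<C> \<subseteq> carrier G" using \<C> rcosets_part_G[OF N] by blast
  have "card N * card \<C> = card (\<Union>\<C>)"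
  proof (rule card_partition)
    show "finite \<C>" "finite (\<Union>\<C>)"
      using sub fin finite_subset finite_UnionD by metis+
    show "card c = card N" if "c \<in> \<C>" for c
      using that \<C> card_rcosets_equal[OF _ subgroup.subset[OF N]] by auto
    show "c1 \<inter> c2 = {}" if "c1 \<in> \<C>" "c2 \<in> \<C>" "c1 \<noteq> c2" for c1 c2
      using that \<C> pairwiseD[OF rcos_disjoint[OF N], of c1 c2] by (auto simp: disjnt_def)
  qed
  then show ?thesis by (simp add: mult.commute)
qed

text \<open>Both \<open>S\<close> and its image consist of the same number of cosets, of \<open>N\<close> and of \<open>L\<close>
  respectively, and \<open>N\<close> and \<open>L\<close> have the same index.\<close>

lemma card_rcosets_coset_image:
  assumes A: "group A" and B: "group B"
    and finA: "finite (carrier A)" and finB: "finite (carrier B)"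
    and N: "subgroup N A" and L: "subgroup L B"
    and f: "bij_betw f (rcosets\<^bsub>A\<^esub> N) (rcosets\<^bsub>B\<^esub> L)"
    and S: "subgroup S A" and NS: "N \<subseteq> S"
    and T: "subgroup (coset_image A N f S) B"
  shows "card (rcosets\<^bsub>A\<^esub> S) = card (rcosets\<^bsub>B\<^esub> (coset_image A N f S))"
proof -
  interpret A: group A by fact
  interpret B: group B by fact
  define \<C> where "\<C> = {C \<in> rcosets\<^bsub>A\<^esub> N. C \<subseteq> S}"
  have \<C>: "\<C> \<subseteq> rcosets\<^bsub>A\<^esub> N" by (auto simp: \<C>_def)
  have T_eq: "coset_image A N f S = \<Union> (f ` \<C>)"
    by (simp add: coset_image_def \<C>_def FactGroup_def)
  have "S \<subseteq> \<Union>\<C>"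
  proof
    fix s assume s: "s \<in> S"
    then have sc: "s \<in> carrier A" using S subgroup.mem_carrier by metis
    have "N #>\<^bsub>A\<^esub> s \<subseteq> S"
      using NS s subgroup.m_closed[OF S] by (auto simp: r_coset_def)
    moreover have "N #>\<^bsub>A\<^esub> s \<in> rcosets\<^bsub>A\<^esub> N" using sc by (auto simp: RCOSETS_def)
    moreover have "s \<in> N #>\<^bsub>A\<^esub> s" using A.rcos_self[OF sc N] .
    ultimately show "s \<in> \<Union>\<C>" unfolding \<C>_def by blast
  qed
  then have S_eq: "\<Union>\<C> = S" unfolding \<C>_def by blast
  have cS: "card S = card \<C> * card N"
    using A.card_Union_rcosets[OF finA N \<C>] S_eq by simp
  have "inj_on f \<C>" using f \<C> by (meson bij_betw_def inj_on_subset)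
  moreover have "f ` \<C> \<subseteq> rcosets\<^bsub>B\<^esub> L" using f \<C> unfolding bij_betw_def by blast
  ultimately have cT: "card (coset_image A N f S) = card \<C> * card L"
    using B.card_Union_rcosets[OF finB L] T_eq card_image by metis
  have same_index: "card (rcosets\<^bsub>A\<^esub> N) = card (rcosets\<^bsub>B\<^esub> L)"
    using f bij_betw_same_card by blast
  have pos: "card N > 0" "card L > 0" "card S > 0"
    using N L S finA finB subgroup.finite_imp_card_positive by blast+
  have "card \<C> > 0" using pos cS by (metis mult_is_0 neq0_conv)
  have "card (rcosets\<^bsub>A\<^esub> S) * card \<C> * card N = card (rcosets\<^bsub>A\<^esub> N) * card N"
    using A.lagrange[OF S] A.lagrange[OF N] cS by (simp add: mult.assoc)
  moreover have "card (rcosets\<^bsub>B\<^esub> (coset_image A N f S)) * card \<C> * card L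
      = card (rcosets\<^bsub>B\<^esub> L) * card L"
    using B.lagrange[OF T] B.lagrange[OF L] cT by (simp add: mult.assoc)
  ultimately have "card (rcosets\<^bsub>A\<^esub> S) * card \<C>
      = card (rcosets\<^bsub>B\<^esub> (coset_image A N f S)) * card \<C>"
    using pos same_index by simp
  then show ?thesis using \<open>card \<C> > 0\<close> by simp
qed

theorem theorem3p9:
  fixes I :: "'i set"
    and G :: "'i \<Rightarrow> 'a monoid"
    and E :: "('i \<times> 'i) set"
    and H K :: "'i \<Rightarrow> 'i \<Rightarrow> 'a set"
    and \<phi> :: "'i \<Rightarrow> 'i \<Rightarrow> 'a set \<Rightarrow> 'a set"
    and m :: "'i \<Rightarrow> 'i \<Rightarrow> nat"
  assumes "group_pair I G E H K \<phi>"
    and "\<And>x. x \<in> I \<Longrightarrow> finite (carrier (G x))"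
    and "\<And>x. x \<in> I \<Longrightarrow> cyclic_group (G x)"
    and "frame_conditions I G E H K \<phi>"
    and "\<And>x y. (x, y) \<in> E \<Longrightarrow> m x y = order (G x Mod H x y)"
  shows "index_conditions I G E m"
proof -
  interpret group_pair I G E H K \<phi> by fact
  note fin = assms(2) and cyc = assms(3) and frame = assms(4) and m = assms(5)
  have in_I: "x \<in> I \<and> y \<in> I" if "(x, y) \<in> E" for x y
    using that equiv_E by (auto simp: equiv_def refl_on_def)
  have sym: "(y, x) \<in> E" if "(x, y) \<in> E" for x y
    using that equiv_E by (meson equivE symD)
  have trans: "(x, z) \<in> E" if "(x, y) \<in> E" "(y, z) \<in> E" for x y z
    using that equiv_E by (meson equivE transD)
  have refl: "(x, x) \<in> E" if "x \<in> I" for x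
    using that equiv_E by (meson equivE refl_onD)
  have H: "subgroup (H x y) (G x)" and K: "subgroup (K x y) (G y)" if "(x, y) \<in> E" for x y
    using that normal_H normal_K normal_imp_subgroup by blast+
  have bij: "bij_betw (\<phi> x y) (rcosets\<^bsub>G x\<^esub> (H x y)) (rcosets\<^bsub>G y\<^esub> (K x y))"
    if "(x, y) \<in> E" for x y
    using iso_\<phi>[OF that] by (simp add: iso_def FactGroup_def)
  have m_H: "m x y = card (rcosets\<^bsub>G x\<^esub> (H x y))" if "(x, y) \<in> E" for x y
    using m[OF that] by (simp add: order_def FactGroup_def)
  have m_K: "m x y = card (rcosets\<^bsub>G y\<^esub> (K x y))" if "(x, y) \<in> E" for x y
    using m_H[OF that] bij_betw_same_card[OF bij[OF that]] by simp
  have lagrange_H: "m x y * card (H x y) = order (G x)" if "(x, y) \<in> E" for x y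
    using group.lagrange[OF group_G H[OF that]] in_I[OF that] m_H[OF that] by simp
  have lagrange_K: "m x y * card (K x y) = order (G y)" if "(x, y) \<in> E" for x y
    using group.lagrange[OF group_G K[OF that]] in_I[OF that] m_K[OF that] by simp
  have order_pos: "order (G x) > 0" if "x \<in> I" for x
    using fin[OF that] group.is_monoid[OF group_G[OF that]] monoid.order_gt_0_iff_finite by blast
  have pos: "m x y > 0" if "(x, y) \<in> E" for x y
    using lagrange_H[OF that] order_pos in_I[OF that] by (metis mult_is_0 neq0_conv)
  have m_dvd: "m x y dvd order (G x) \<and> m x y dvd order (G y)" if "(x, y) \<in> E" for x y
    using lagrange_H[OF that] lagrange_K[OF that] by (metis dvd_triv_left)
  have m_refl: "m x x = order (G x)" if "x \<in> I" for x
  proof -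
    have "H x x = {\<one>\<^bsub>G x\<^esub>}" using frame that unfolding frame_conditions_def by blast
    then show ?thesis using lagrange_H[OF refl[OF that]] by simp
  qed
  have m_sym: "m y x = m x y" if "(x, y) \<in> E" for x y
  proof -
    have "H y x = K x y" using frame that unfolding frame_conditions_def by blast
    then show ?thesis using m_H[OF sym[OF that]] m_K[OF that] by simp
  qed
  have gcd_eq: "gcd (m x y) (m x z) = gcd (m x y) (m y z)"
    if xy: "(x, y) \<in> E" and yz: "(y, z) \<in> E" for x y z
  proof -
    have xz: "(x, z) \<in> E" using trans[OF xy yz] .
    have x: "x \<in> I" and y: "y \<in> I" using in_I[OF xy] by auto
    interpret X: comm_group "G x"
      using x group_G cyc group.cyclic_imp_abelian_group by blast
    interpret Y: comm_group "G y"
      using y group_G cyc group.cyclic_imp_abelian_group by blast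
    let ?S = "H x y <#>\<^bsub>G x\<^esub> H x z" and ?T = "K x y <#>\<^bsub>G y\<^esub> H y z"
    have im: "coset_image (G x) (H x y) (\<phi> x y) ?S = ?T"
      using frame xy yz unfolding frame_conditions_def by blast
    have S: "subgroup ?S (G x)" using X.mult_subgroups H xy xz by blast
    have T: "subgroup ?T (G y)" using Y.mult_subgroups H K xy yz by blast
    have "H x y \<subseteq> ?S"
      using subgroup.one_closed[OF H[OF xz]] subgroup.mem_carrier[OF H[OF xy]]
      unfolding set_mult_def by force
    then have "card (rcosets\<^bsub>G x\<^esub> ?S) = card (rcosets\<^bsub>G y\<^esub> ?T)"
      using card_rcosets_coset_image[OF X.is_group Y.is_group fin[OF x] fin[OF y]
          H[OF xy] K[OF xy] bij[OF xy] S] im T by simp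
    then show ?thesis
      using X.card_rcosets_set_mult[OF fin[OF x] cyc[OF x] H[OF xy] H[OF xz]]
        Y.card_rcosets_set_mult[OF fin[OF y] cyc[OF y] K[OF xy] H[OF yz]]
        m_H[OF xy] m_H[OF xz] m_K[OF xy] m_H[OF yz] by simp
  qed
  have "gcd (m x y) (m y z) = gcd (m x y) (m x z) \<and> gcd (m x y) (m x z) = gcd (m x z) (m y z)"
    if xy: "(x, y) \<in> E" and yz: "(y, z) \<in> E" for x y z
  proof -
    have "gcd (m x z) (m x y) = gcd (m x z) (m z y)"
      using gcd_eq[OF trans[OF xy yz] sym[OF yz]] .
    then show ?thesis
      using gcd_eq[OF xy yz] m_sym[OF yz] by (simp add: gcd.commute)
  qed
  then show ?thesis
    unfolding index_conditions_def using pos m_dvd m_refl m_sym by blast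
qed

end
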